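(* Let $A\in\mathbb{R}^{n\times d}$ have full column rank, let $b\in\mathbb{R}^n$, $T\in\mathbb{N}$, and let $\mathcal{T}$ be a $(\overline{p},\overline{\alpha},\overline{\beta})$ column paving of $A$. Let $x_T$ be the output of the Randomized Block Least Squares Solver (described in the context) run for $T$ iterations on input $A,b$ with column partition $\mathcal{T}$. Then $$\mathbb{E}\|x_{LS}-x_T\|_2^2\le\left(1-\frac{\sigma_{\min}^2(A)}{\overline{p}\,\overline{\beta}}\right)^T\kappa^2(A)\,\|x_{LS}\|_2^2.$$
   Context: Notation: $A^\dagger$ is the Moore-Penrose pseudoinverse; $x_{LS}=A^\dagger b$; $\sigma_{\min}(A)$ and $\sigma_{\max}(A)$ are the smallest nonzero and the largest singular values of $A$; $\kappa(A)=\sigma_{\max}(A)/\sigma_{\min}(A)$. Column paving: a $(\overline{p},\overline{\alpha},\overline{\beta})$ column paving of an $n\times d$ matrix $A$ is a partition $\{\tau_1,\dots,\tau_{\overline{p}}\}$ of the column index set $[d]=\{1,\dots,d\}$ into $\overline{p}$ nonempty blocks such that for each block $\tau$, $\overline{\alpha}\le\lambda_{\min}(A_\tau^*A_\tau)$ and $\lambda_{\max}(A_\tau^*A_\tau)\le\overline{\beta}$, where $A_\tau$ is the $n\times|\tau|$ submatrix of $A$ with columns indexed by $\tau$. Randomized Block Least Squares Solver: given a column partition $\mathcal{T}$ of $[d]$, set $x_0=0\in\mathbb{R}^d$ and $z_0=b$. For $k=1,2,\dots,T$: pick $\tau_k\in\mathcal{T}$ uniformly at random (independently of previous picks); compute $w_k=(A_{\tau_k})^\dagger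 z_{k-1}$; update $(x_k)_{\tau_k}=(x_{k-1})_{\tau_k}+w_k$, leaving the coordinates of $x_{k-1}$ outside $\tau_k$ unchanged; set $z_k=z_{k-1}-A_{\tau_k}w_k$. Output $x_T$. Here $v_\tau$ denotes the restriction of a vector $v$ to the coordinates in $\tau$. The expectation is over all random picks. *)

theory Defs
  imports
    "HOL-Probability.Probability_Mass_Function"
    "HOL-Library.Disjoint_Sets"
    "Jordan_Normal_Form.DL_Rank"
    "Jordan_Normal_Form.DL_Submatrix"
    "Jordan_Normal_Form.Spectral_Radius"
begin

hide_type (open) Finite_Cartesian_Product.vec
hide_const (open) Finite_Cartesian_Product.vec

definition norm2 :: "real vec \<Rightarrow> real" where
  "norm2 v = sqrt (scalar_prod v v)"

definition is_moore_penrose :: "real mat \<Rightarrow> real mat \<Rightarrow> bool" where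
  "is_moore_penrose A X \<longleftrightarrow>
     X \<in> carrier_mat (dim_col A) (dim_row A) \<and>
     A * X * A = A \<and> X * A * X = X \<and>
     transpose_mat (A * X) = A * X \<and> transpose_mat (X * A) = X * A"

definition pinv :: "real mat \<Rightarrow> real mat" where
  "pinv A = (THE X. is_moore_penrose A X)"

definition x_LS :: "real mat \<Rightarrow> real vec \<Rightarrow> real vec" where
  "x_LS A b = pinv A *\<^sub>v b"

text \<open>The extremal eigenvalues are only applied to Gram matrices; these are real symmetric, so that
  the real spectrum is the whole spectrum.\<close>

definition lambda_min :: "real mat \<Rightarrow> real" where
  "lambda_min M = Min (spectrum M)"

definition lambda_max :: "real mat \<Rightarrow> real" where
  "lambda_max M = Max (spectrum M)"

text \<open>For a matrix with more columns than rows this set has the additional element 0 compared with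
  the convention of \<open>min n d\<close> singular values; this affects neither the largest nor the smallest
  nonzero one.\<close>

definition singular_values :: "real mat \<Rightarrow> real set" where
  "singular_values A = sqrt ` spectrum (transpose_mat A * A)"

definition sigma_max :: "real mat \<Rightarrow> real" where
  "sigma_max A = Max (singular_values A)"

definition sigma_min :: "real mat \<Rightarrow> real" where
  "sigma_min A = Min (singular_values A - {0})"

definition kappa :: "real mat \<Rightarrow> real" where
  "kappa A = sigma_max A / sigma_min A"

text \<open>Columns are indexed by \<open>{0..<d}\<close>. The columns of the submatrix are those with index in
  \<open>\<tau>\<close>, in increasing order.\<close>

definition col_submatrix :: "real mat \<Rightarrow> nat set \<Rightarrow> real mat" where
  "col_submatrix A \<tau> = submatrix A UNIV \<tau>"

definition column_paving ::
    "real mat \<Rightarrow> nat \<Rightarrow> real \<Rightarrow> real \<Rightarrow> nat set set \<Rightarrow> bool" where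
  "column_paving A p \<alpha> \<beta> P \<longleftrightarrow>
     partition_on {0..<dim_col A} P \<and> card P = p \<and>
     (\<forall>\<tau>\<in>P. \<alpha> \<le> lambda_min (transpose_mat (col_submatrix A \<tau>) * col_submatrix A \<tau>) \<and>
             lambda_max (transpose_mat (col_submatrix A \<tau>) * col_submatrix A \<tau>) \<le> \<beta>)"

text \<open>Adding \<open>w\<close> to the restriction of \<open>x\<close> to \<open>\<tau>\<close>: the coordinate of \<open>w\<close> that belongs to
  \<open>j \<in> \<tau>\<close> is the position of \<open>j\<close> in the increasing enumeration of \<open>\<tau>\<close>.\<close>

definition block_add :: "nat set \<Rightarrow> real vec \<Rightarrow> real vec \<Rightarrow> real vec" where
  "block_add \<tau> x w = vec (dim_vec x) (\<lambda>j.
     if j \<in> \<tau> then vec_index x j + vec_index w (card {i \<in> \<tau>. i < j}) else vec_index x j)"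

lemma block_add_pick:
  assumes "\<tau> \<subseteq> {0..<dim_vec x}" "l < card \<tau>"
  shows "vec_index (block_add \<tau> x w) (pick \<tau> l) = vec_index x (pick \<tau> l) + vec_index w l"
proof -
  have "pick \<tau> l \<in> \<tau>" using assms(2) by (rule pick_in_set_le)
  moreover have "card {i \<in> \<tau>. i < pick \<tau> l} = l" using assms(2) by (rule card_pick_le)
  ultimately show ?thesis using assms(1) by (auto simp: block_add_def)
qed

definition rbls_step ::
    "real mat \<Rightarrow> nat set \<Rightarrow> real vec \<times> real vec \<Rightarrow> real vec \<times> real vec" where
  "rbls_step A \<tau> = (\<lambda>(x, z).
     let w = pinv (col_submatrix A \<tau>) *\<^sub>v z
     in (block_add \<tau> x w, z - col_submatrix A \<tau> *\<^sub>v w))"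

text \<open>The joint distribution of \<open>(x\<^sub>k, z\<^sub>k)\<close>.\<close>

primrec rbls_state ::
    "real mat \<Rightarrow> real vec \<Rightarrow> nat set set \<Rightarrow> nat \<Rightarrow> (real vec \<times> real vec) pmf" where
  "rbls_state A b P 0 = return_pmf (0\<^sub>v (dim_col A), b)"
| "rbls_state A b P (Suc k) =
     bind_pmf (rbls_state A b P k) (\<lambda>s.
       map_pmf (\<lambda>\<tau>. rbls_step A \<tau> s) (pmf_of_set P))"

definition rbls_output :: "real mat \<Rightarrow> real vec \<Rightarrow> nat set set \<Rightarrow> nat \<Rightarrow> real vec pmf" where
  "rbls_output A b P T = map_pmf fst (rbls_state A b P T)"

end

theory Submission
  imports Defs
begin

text \<open>Measure the error of an iterate \<open>x\<close> by \<open>|A (x\<^sub>L\<^sub>S - x)|\<^sup>2\<close>. A step with block \<open>\<tau>\<close> projects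
  \<open>y = A (x\<^sub>L\<^sub>S - x)\<close> orthogonally off the range of \<open>A\<^sub>\<tau>\<close>, which removes at least
  \<open>|A\<^sub>\<tau>\<^sup>T y|\<^sup>2 / \<beta>\<close> from it. These terms add up to \<open>|A\<^sup>T y|\<^sup>2 / \<beta>\<close> over the blocks, and
  \<open>|A\<^sup>T y|\<^sup>2 \<ge> \<sigma>\<^sub>m\<^sub>i\<^sub>n\<^sup>2 |y|\<^sup>2\<close> because \<open>y\<close> lies in the range of \<open>A\<close>; hence the expected error contracts by
  \<open>1 - \<sigma>\<^sub>m\<^sub>i\<^sub>n\<^sup>2 / (p \<beta>)\<close> per step. Passing from \<open>|x\<^sub>L\<^sub>S - x|\<close> to \<open>|A (x\<^sub>L\<^sub>S - x)|\<close> at both ends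
  costs the factor \<open>\<kappa>\<^sup>2\<close>.

  The Rayleigh bounds for a symmetric matrix \<open>S\<close> are obtained without diagonalisation: the largest
  \<open>m\<close> with \<open>m |v|\<^sup>2 \<le> v \<bullet> S v\<close> for all \<open>v\<close> must be an eigenvalue, since otherwise \<open>S - m I\<close>
  would be positive semidefinite and invertible, and \<open>m\<close> could be increased.\<close>

unbundle no vec_syntax and no inner_syntax

section \<open>Inner products and boundedness of matrices\<close>

lemma sprod_self_nonneg: "0 \<le> v \<bullet> (v :: real vec)"
  unfolding scalar_prod_def by (intro sum_nonneg) auto

lemma sprod_self_eq_0_iff:
  assumes "(v :: real vec) \<in> carrier_vec n"
  shows "v \<bullet> v = 0 \<longleftrightarrow> v = 0\<^sub>v n"
  using assms unfolding scalar_prod_def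
  by (subst sum_nonneg_eq_0_iff) (auto intro!: eq_vecI)

lemma norm2_square: "(norm2 v)\<^sup>2 = v \<bullet> v"
  unfolding norm2_def using sprod_self_nonneg by simp

lemma sprod_Cauchy_Schwarz:
  assumes "(u :: real vec) \<in> carrier_vec n" "v \<in> carrier_vec n"
  shows "(u \<bullet> v)\<^sup>2 \<le> (u \<bullet> u) * (v \<bullet> v)"
  using Cauchy_Schwarz_ineq_sum[of "vec_index u" "vec_index v" "{0..<n}"] assms
  unfolding scalar_prod_def by (simp add: power2_eq_square)

lemma mult_mat_vec_bounded:
  fixes M :: "real mat"
  assumes "M \<in> carrier_mat n d"
  obtains C where "C > 0"
    "\<And>v. v \<in> carrier_vec d \<Longrightarrow> (M *\<^sub>v v) \<bullet> (M *\<^sub>v v) \<le> C * (v \<bullet> v)"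
proof
  \<comment> \<open>The squared Frobenius norm of \<open>M\<close>, enlarged by 1 so that it stays
    positive for a zero matrix and may be divided by.\<close>
  let ?C = "(\<Sum>i<n. row M i \<bullet> row M i) + 1"
  show "?C > 0"
    by (intro add_nonneg_pos sum_nonneg sprod_self_nonneg) auto
  fix v :: "real vec" assume v: "v \<in> carrier_vec d"
  have "(M *\<^sub>v v) \<bullet> (M *\<^sub>v v) = (\<Sum>i<n. (row M i \<bullet> v)\<^sup>2)"
    using assms unfolding scalar_prod_def[of "M *\<^sub>v v"]
    by (auto simp: power2_eq_square intro!: sum.cong)
  also have "\<dots> \<le> (\<Sum>i<n. (row M i \<bullet> row M i) * (v \<bullet> v))"
    by (intro sum_mono sprod_Cauchy_Schwarz[where n = d]) (use assms v in auto)
  also have "\<dots> \<le> ?C * (v \<bullet> v)"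
    using sprod_self_nonneg[of v] by (simp add: sum_distrib_right distrib_right)
  finally show "(M *\<^sub>v v) \<bullet> (M *\<^sub>v v) \<le> ?C * (v \<bullet> v)" .
qed

lemma quadratic_form_bounded:
  fixes M :: "real mat"
  assumes M: "M \<in> carrier_mat n n"
  obtains K where "K > 0"
    "\<And>v. v \<in> carrier_vec n \<Longrightarrow> \<bar>v \<bullet> (M *\<^sub>v v)\<bar> \<le> K * (v \<bullet> v)"
proof -
  obtain C where C: "C > 0"
    "\<And>v. v \<in> carrier_vec n \<Longrightarrow> (M *\<^sub>v v) \<bullet> (M *\<^sub>v v) \<le> C * (v \<bullet> v)"
    using mult_mat_vec_bounded[OF M] by blast
  have "\<bar>v \<bullet> (M *\<^sub>v v)\<bar> \<le> (1 + C) * (v \<bullet> v)" if v: "v \<in> carrier_vec n" for v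
  proof (rule power2_le_imp_le)
    define s where "s = v \<bullet> v"
    have s: "s \<ge> 0" by (simp add: s_def sprod_self_nonneg)
    have "(v \<bullet> (M *\<^sub>v v))\<^sup>2 \<le> s * ((M *\<^sub>v v) \<bullet> (M *\<^sub>v v))"
      using sprod_Cauchy_Schwarz[of v n "M *\<^sub>v v"] M v by (simp add: s_def)
    also have "\<dots> \<le> s * (C * s)"
      using C(2)[OF v] s by (intro mult_left_mono) (auto simp: s_def)
    \<comment> \<open>Cauchy-Schwarz gives the constant sqrt C;
      \<open>C \<le> (1 + C)\<^sup>2\<close> avoids the root.\<close>
    also have "\<dots> \<le> ((1 + C) * s)\<^sup>2"
      using C(1) by (simp add: power2_eq_square algebra_simps)
    finally show "\<bar>v \<bullet> (M *\<^sub>v v)\<bar>\<^sup>2 \<le> ((1 + C) * (v \<bullet> v))\<^sup>2"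
      by (simp add: s_def)
    show "0 \<le> (1 + C) * (v \<bullet> v)" using C(1) s by (simp add: s_def)
  qed
  then show ?thesis using that[of "1 + C"] C(1) by simp
qed

section \<open>Rayleigh bounds for symmetric matrices\<close>

lemma left_inverse_if_det_nonzero:
  fixes M :: "'a :: field mat"
  assumes "M \<in> carrier_mat n n" "det M \<noteq> 0"
  obtains B where "B \<in> carrier_mat n n" "B * M = 1\<^sub>m n" "M * B = 1\<^sub>m n"
  using det_non_zero_imp_unit[OF assms, where b = "()"]
  by (auto simp: Units_def ring_mat_def)

lemma symmetric_sprod:
  fixes N :: "real mat"
  assumes "N \<in> carrier_mat n n" "transpose_mat N = N" "u \<in> carrier_vec n" "v \<in> carrier_vec n"
  shows "(N *\<^sub>v u) \<bullet> v = u \<bullet> (N *\<^sub>v v)"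
  using transpose_vec_mult_scalar[OF assms(1,4,3)] assms(2) by simp

text \<open>For the quadratic form \<open>q\<close> of \<open>N\<close>, bounded by \<open>K |v|\<^sup>2\<close>, nonnegativity of
  \<open>q (v - t N v)\<close> at \<open>t = 1 / K\<close> yields \<open>|N v|\<^sup>2 \<le> K q(v)\<close>; invertibility bounds \<open>|v|\<close> by \<open>|N v|\<close>.\<close>

lemma psd_invertible_coercive:
  fixes N :: "real mat"
  assumes N: "N \<in> carrier_mat n n" and sym: "transpose_mat N = N"
    and psd: "\<And>v. v \<in> carrier_vec n \<Longrightarrow> 0 \<le> v \<bullet> (N *\<^sub>v v)"
    and det: "det N \<noteq> 0"
  obtains \<epsilon> where "\<epsilon> > 0"
    "\<And>v. v \<in> carrier_vec n \<Longrightarrow> \<epsilon> * (v \<bullet> v) \<le> v \<bullet> (N *\<^sub>v v)"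
proof -
  obtain B where B: "B \<in> carrier_mat n n" "B * N = 1\<^sub>m n"
    using left_inverse_if_det_nonzero[OF N det] by blast
  obtain D where D: "D > 0"
    "\<And>v. v \<in> carrier_vec n \<Longrightarrow> (B *\<^sub>v v) \<bullet> (B *\<^sub>v v) \<le> D * (v \<bullet> v)"
    using mult_mat_vec_bounded[OF B(1)] by blast
  obtain K where K: "K > 0"
    "\<And>v. v \<in> carrier_vec n \<Longrightarrow> \<bar>v \<bullet> (N *\<^sub>v v)\<bar> \<le> K * (v \<bullet> v)"
    using quadratic_form_bounded[OF N] by blast
  have "1 / (D * K) * (v \<bullet> v) \<le> v \<bullet> (N *\<^sub>v v)" if v: "v \<in> carrier_vec n" for v
  proof -
    define u where "u = N *\<^sub>v v"
    have u: "u \<in> carrier_vec n" using N v by (simp add: u_def)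
    have Nu: "N *\<^sub>v u \<in> carrier_vec n" using N u by simp
    define s where "s = u \<bullet> u"
    have uNu: "u \<bullet> (N *\<^sub>v u) \<le> K * s"
      using K(2)[OF u] by (simp add: s_def)
    define t where "t = 1 / K"
    let ?w = "v + (-t) \<cdot>\<^sub>v u"
    have w: "?w \<in> carrier_vec n" using u v by simp
    have Nw: "N *\<^sub>v ?w = u + (-t) \<cdot>\<^sub>v (N *\<^sub>v u)"
      using N u v by (simp add: mult_add_distrib_mat_vec[of _ n n] mult_mat_vec u_def)
    have vNu: "v \<bullet> (N *\<^sub>v u) = s"
      using symmetric_sprod[OF N sym v u] by (simp add: s_def u_def)
    have "?w \<bullet> (N *\<^sub>v ?w)
      = v \<bullet> u - t * s + (-t) * s + t * t * (u \<bullet> (N *\<^sub>v u))"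
      unfolding Nw using u v Nu vNu
      by (simp add: add_scalar_prod_distrib[of _ n] scalar_prod_add_distrib[of _ n] s_def
          algebra_simps)
    \<comment> \<open>At \<open>t = 1 / K\<close> the second-order term is at most
      \<open>t * s\<close> and cancels one of the two cross terms, which leaves
      \<open>v \<bullet> u - t * s\<close>.\<close>
    also have "t * t * (u \<bullet> (N *\<^sub>v u)) \<le> t * t * (K * s)"
      by (intro mult_left_mono uNu) auto
    also have "t * t * (K * s) = t * s" using K(1) by (simp add: t_def)
    finally have "t * s \<le> v \<bullet> u" using psd[OF w] by linarith
    moreover have "v \<bullet> v \<le> D * s"
      using D(2)[OF u] B N v assoc_mult_mat_vec[OF B(1) N v] by (simp add: u_def s_def)
    ultimately have "v \<bullet> v \<le> D * (K * (v \<bullet> u))"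
      using K(1) D(1) by (auto simp: t_def field_simps elim: order_trans)
    then show ?thesis using K(1) D(1) by (simp add: u_def field_simps)
  qed
  then show ?thesis using that[of "1 / (D * K)"] D(1) K(1) by simp
qed

lemma char_matrix_mult_vec:
  fixes S :: "'a :: field mat"
  assumes "S \<in> carrier_mat n n" "v \<in> carrier_vec n"
  shows "char_matrix S m *\<^sub>v v = S *\<^sub>v v + (- m) \<cdot>\<^sub>v v"
  using assms unfolding char_matrix_def
  by (auto simp: add_scalar_prod_distrib[of _ n] intro!: eq_vecI)

lemma rayleigh_min:
  fixes S :: "real mat"
  assumes S: "S \<in> carrier_mat n n" and sym: "transpose_mat S = S" and n: "n > 0"
  obtains m where "m \<in> spectrum S"
    "\<And>v. v \<in> carrier_vec n \<Longrightarrow> m * (v \<bullet> v) \<le> v \<bullet> (S *\<^sub>v v)"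
proof -
  define L where "L = {m. \<forall>v\<in>carrier_vec n. m * (v \<bullet> v) \<le> v \<bullet> (S *\<^sub>v v)}"
  obtain K where K: "K > 0"
    "\<And>v. v \<in> carrier_vec n \<Longrightarrow> \<bar>v \<bullet> (S *\<^sub>v v)\<bar> \<le> K * (v \<bullet> v)"
    using quadratic_form_bounded[OF S] by blast
  have "- K \<in> L"
    using K(2) by (fastforce simp: L_def abs_le_iff)
  then have L_ne: "L \<noteq> {}" by auto
  have L_le: "m * (v \<bullet> v) \<le> v \<bullet> (S *\<^sub>v v)" if "m \<in> L" "v \<in> carrier_vec n" for m v
    using that by (auto simp: L_def)
  \<comment> \<open>The unit vector of index 0, available since \<open>n > 0\<close>, is a test
    vector of norm 1 that bounds every element of \<open>L\<close>.\<close>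
  have L_bdd: "bdd_above L"
  proof (rule bdd_aboveI)
    fix m assume "m \<in> L"
    from L_le[OF this, of "unit_vec n 0"] n
    show "m \<le> unit_vec n 0 \<bullet> (S *\<^sub>v unit_vec n 0)" by simp
  qed
  define m where "m = Sup L"
  \<comment> \<open>The supremum is attained: for nonzero \<open>v\<close> the Rayleigh quotient is
    an upper bound of \<open>L\<close>, hence at least \<open>m\<close>.\<close>
  have m: "m * (v \<bullet> v) \<le> v \<bullet> (S *\<^sub>v v)" if v: "v \<in> carrier_vec n" for v
  proof (cases "v \<bullet> v = 0")
    case True
    then have "v = 0\<^sub>v n" using sprod_self_eq_0_iff[OF v] by simp
    then show ?thesis using S by simp
  next
    case False
    then have pos: "v \<bullet> v > 0" using sprod_self_nonneg[of v] by simp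
    have "m \<le> v \<bullet> (S *\<^sub>v v) / (v \<bullet> v)"
      unfolding m_def using pos L_le[OF _ v] by (intro cSup_least L_ne) (auto simp: field_simps)
    then show ?thesis using pos by (simp add: field_simps)
  qed
  let ?N = "char_matrix S m"
  have N: "?N \<in> carrier_mat n n" using S by simp
  have "transpose_mat ?N = transpose_mat S + transpose_mat ((- m) \<cdot>\<^sub>m 1\<^sub>m n)"
    using S unfolding char_matrix_def by (subst transpose_add) auto
  also have "\<dots> = ?N"
    using S sym unfolding char_matrix_def by (auto intro!: eq_matI)
  finally have symN: "transpose_mat ?N = ?N" .
  have q: "v \<bullet> (?N *\<^sub>v v) = v \<bullet> (S *\<^sub>v v) - m * (v \<bullet> v)"
    if "v \<in> carrier_vec n" for v
    using S that by (simp add: char_matrix_mult_vec scalar_prod_add_distrib[of _ n])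
  have "det ?N = 0"
  proof (rule ccontr)
    assume "det ?N \<noteq> 0"
    then obtain e where e: "e > 0"
      "\<And>v. v \<in> carrier_vec n \<Longrightarrow> e * (v \<bullet> v) \<le> v \<bullet> (?N *\<^sub>v v)"
      using psd_invertible_coercive[OF N symN] m q by (metis diff_ge_0_iff_ge)
    have "m + e \<in> L"
      using e(2) q by (auto simp: L_def algebra_simps)
    then have "m + e \<le> m" unfolding m_def by (rule cSup_upper[OF _ L_bdd])
    then show False using e(1) by simp
  qed
  then have "m \<in> spectrum S" using eigenvalue_det[OF S] by (simp add: spectrum_def)
  then show ?thesis using that m by blast
qed

text \<open>Passing to \<open>- S\<close> negates both the spectrum and the quadratic form, so this
  is \<open>rayleigh_min\<close> for \<open>- S\<close>.\<close>

lemma rayleigh_max: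
  fixes S :: "real mat"
  assumes S: "S \<in> carrier_mat n n" and sym: "transpose_mat S = S" and n: "n > 0"
  obtains m where "m \<in> spectrum S"
    "\<And>v. v \<in> carrier_vec n \<Longrightarrow> v \<bullet> (S *\<^sub>v v) \<le> m * (v \<bullet> v)"
proof -
  have "- S \<in> carrier_mat n n" "transpose_mat (- S) = - S"
    using S sym by (auto simp: transpose_uminus)
  from rayleigh_min[OF this n] obtain m where m: "m \<in> spectrum (- S)"
    "\<And>v. v \<in> carrier_vec n \<Longrightarrow> m * (v \<bullet> v) \<le> v \<bullet> (- S *\<^sub>v v)"
    by blast
  have neg: "- S *\<^sub>v v = - (S *\<^sub>v v)" if "v \<in> carrier_vec n" for v
    using S that by (auto intro!: eq_vecI)
  from m(1) obtain v where v: "v \<in> carrier_vec n" "v \<noteq> 0\<^sub>v n" "- S *\<^sub>v v = m \<cdot>\<^sub>v v"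
    using S by (auto simp: spectrum_def eigenvalue_def eigenvector_def)
  have "S *\<^sub>v v = (- m) \<cdot>\<^sub>v v"
    using arg_cong[OF v(3), of uminus] neg[OF v(1)] by (auto intro!: eq_vecI)
  then have "- m \<in> spectrum S"
    using S v by (auto simp: spectrum_def eigenvalue_def eigenvector_def)
  moreover have "v \<bullet> (S *\<^sub>v v) \<le> (- m) * (v \<bullet> v)" if "v \<in> carrier_vec n" for v
    using m(2)[OF that] neg[OF that] S that by simp
  ultimately show ?thesis using that by blast
qed

section \<open>The pseudoinverse and the normal equations\<close>

text \<open>Inserting \<open>A * Y * A = A\<close> and transposing swaps the symmetric factors, so
  \<open>A * X = A * Y\<close> and \<open>X * A = Y * A\<close>; then X = XAX = YAX = YAY. This
  makes the description in \<open>pinv\<close> determinate once a solution exists.\<close>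

lemma is_moore_penrose_unique:
  assumes X: "is_moore_penrose A X" and Y: "is_moore_penrose A Y"
  shows "X = Y"
proof -
  define n d where "n = dim_row A" and "d = dim_col A"
  have A: "A \<in> carrier_mat n d" by (simp add: n_def d_def)
  have cX: "X \<in> carrier_mat d n" and cY: "Y \<in> carrier_mat d n"
    using X Y by (auto simp: is_moore_penrose_def n_def d_def)
  have AX: "A * X \<in> carrier_mat n n" and AY: "A * Y \<in> carrier_mat n n"
    and XA: "X * A \<in> carrier_mat d d" and YA: "Y * A \<in> carrier_mat d d"
    using A cX cY by auto
  have "A * X = transpose_mat (A * Y * A * X)"
    using X Y by (simp add: is_moore_penrose_def)
  also have "A * Y * A * X = A * Y * (A * X)" using A cX AY by (intro assoc_mult_mat)
  also have "transpose_mat \<dots> = A * X * (A * Y)"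
    using transpose_mult[OF AY AX] X Y by (simp add: is_moore_penrose_def)
  also have "\<dots> = A * X * A * Y" using A cY AX by (intro assoc_mult_mat[symmetric])
  also have "\<dots> = A * Y" using X by (simp add: is_moore_penrose_def)
  finally have eq1: "A * X = A * Y" .
  have "X * A = transpose_mat (X * (A * Y * A))"
    using X Y by (simp add: is_moore_penrose_def)
  also have "X * (A * Y * A) = X * (A * (Y * A))" using A cY by simp
  also have "\<dots> = X * A * (Y * A)" using A cX YA by (intro assoc_mult_mat[symmetric])
  also have "transpose_mat \<dots> = Y * A * (X * A)"
    using transpose_mult[OF XA YA] X Y by (simp add: is_moore_penrose_def)
  also have "\<dots> = Y * (A * (X * A))" using A cY XA by (intro assoc_mult_mat)
  also have "A * (X * A) = A * X * A" using A cX by simp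
  also have "\<dots> = A" using X by (simp add: is_moore_penrose_def)
  finally have eq2: "X * A = Y * A" .
  have "X = X * A * X" using X by (simp add: is_moore_penrose_def)
  also have "\<dots> = Y * (A * X)" unfolding eq2 using A cX cY by (intro assoc_mult_mat)
  also have "\<dots> = Y * A * Y" unfolding eq1 using A cY by (intro assoc_mult_mat[symmetric])
  also have "\<dots> = Y" using Y by (simp add: is_moore_penrose_def)
  finally show ?thesis .
qed

lemma gram_sprod:
  fixes B :: "real mat"
  assumes "B \<in> carrier_mat n k" "v \<in> carrier_vec k"
  shows "v \<bullet> (transpose_mat B * B *\<^sub>v v) = (B *\<^sub>v v) \<bullet> (B *\<^sub>v v)"
proof -
  have "v \<bullet> (transpose_mat B * B *\<^sub>v v) = (transpose_mat B *\<^sub>v (B *\<^sub>v v)) \<bullet> v"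
    using assms by (simp add: comm_scalar_prod[of v k] assoc_mult_mat_vec[of _ k n _ k])
  also have "\<dots> = (B *\<^sub>v v) \<bullet> (B *\<^sub>v v)"
    using assms by (intro transpose_vec_mult_scalar) auto
  finally show ?thesis .
qed

lemma transpose_gram: "transpose_mat (transpose_mat B * B) = transpose_mat B * (B :: real mat)"
  by (subst transpose_mult[of _ "dim_col B" "dim_row B" _ "dim_col B"]) auto

text \<open>A kernel vector \<open>v\<close> of the Gram matrix satisfies |A v|^2 = v . (A^T A v) =
  0, so it is a kernel vector of \<open>A\<close>.\<close>

lemma det_gram_nonzero:
  fixes A :: "real mat"
  assumes A: "A \<in> carrier_mat n d"
    and inj: "\<And>v. v \<in> carrier_vec d \<Longrightarrow> A *\<^sub>v v = 0\<^sub>v n \<Longrightarrow> v = 0\<^sub>v d"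
  shows "det (transpose_mat A * A) \<noteq> 0"
proof
  have G: "transpose_mat A * A \<in> carrier_mat d d" using A by auto
  assume "det (transpose_mat A * A) = 0"
  then obtain v where v: "v \<in> carrier_vec d" "v \<noteq> 0\<^sub>v d" "transpose_mat A * A *\<^sub>v v = 0\<^sub>v d"
    using det_0_iff_vec_prod_zero_field[OF G] by blast
  have "(A *\<^sub>v v) \<bullet> (A *\<^sub>v v) = 0"
    using gram_sprod[OF A v(1)] v(1) unfolding v(3) by simp
  then have "A *\<^sub>v v = 0\<^sub>v n" using sprod_self_eq_0_iff[of "A *\<^sub>v v" n] A v(1) by simp
  with inj v show False by blast
qed

text \<open>For injective \<open>A\<close> the matrix (A^T A)^{-1} A^T satisfies the four Penrose
  conditions; uniqueness identifies it with \<open>pinv A\<close>.\<close>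

lemma is_moore_penrose_pinv:
  fixes A :: "real mat"
  assumes A: "A \<in> carrier_mat n d"
    and inj: "\<And>v. v \<in> carrier_vec d \<Longrightarrow> A *\<^sub>v v = 0\<^sub>v n \<Longrightarrow> v = 0\<^sub>v d"
  shows "is_moore_penrose A (pinv A)"
proof -
  let ?G = "transpose_mat A * A"
  have tA: "transpose_mat A \<in> carrier_mat d n" using A by simp
  have G: "?G \<in> carrier_mat d d" using A by auto
  obtain B where B: "B \<in> carrier_mat d d" "B * ?G = 1\<^sub>m d" "?G * B = 1\<^sub>m d"
    using left_inverse_if_det_nonzero[OF G det_gram_nonzero[OF A inj]] by blast
  have tB: "transpose_mat B \<in> carrier_mat d d" using B by simp
  \<comment> \<open>Transposing \<open>?G * B = 1\<^sub>m d\<close> makes the transpose of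
    \<open>B\<close> a left inverse of \<open>?G\<close> too, so it coincides with
    \<open>B\<close>.\<close>
  have "transpose_mat B * ?G = 1\<^sub>m d"
    using arg_cong[OF B(3), of transpose_mat] transpose_mult[OF G B(1)]
    by (simp add: transpose_gram)
  then have symB: "transpose_mat B = B"
    using assoc_mult_mat[OF tB G B(1)] B tB by simp
  let ?X = "B * transpose_mat A"
  have X: "?X \<in> carrier_mat d n" using B tA by auto
  have XA: "?X * A = 1\<^sub>m d" using assoc_mult_mat[OF B(1) tA A] B by simp
  have AX: "A * ?X = A * B * transpose_mat A" using assoc_mult_mat[OF A B(1) tA] by simp
  have AB: "A * B \<in> carrier_mat n d" using A B by auto
  have "transpose_mat (A * ?X) = A * (B * transpose_mat A)"
    using transpose_mult[OF AB tA] transpose_mult[OF A B(1)] by (simp add: AX symB)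
  moreover have "A * ?X * A = A" using assoc_mult_mat[OF A X A] A by (simp add: XA)
  moreover have "?X * A * ?X = ?X" unfolding XA by (rule left_mult_one_mat[OF X])
  ultimately have "is_moore_penrose A ?X"
    using X A XA by (simp add: is_moore_penrose_def)
  then show ?thesis
    unfolding pinv_def by (rule theI) (use is_moore_penrose_unique \<open>is_moore_penrose A ?X\<close> in blast)
qed

text \<open>With X = \<open>pinv A\<close>, symmetry of A X gives A^T A X = (A X A)^T = A^T. The
  lemma serves twice: for \<open>x_LS\<close> and for the correction \<open>w\<close> computed on a
  single block.\<close>

lemma pinv_normal_equations:
  fixes A :: "real mat"
  assumes A: "A \<in> carrier_mat n d"
    and inj: "\<And>v. v \<in> carrier_vec d \<Longrightarrow> A *\<^sub>v v = 0\<^sub>v n \<Longrightarrow> v = 0\<^sub>v d"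
    and y: "y \<in> carrier_vec n"
  shows "pinv A *\<^sub>v y \<in> carrier_vec d"
    "transpose_mat A *\<^sub>v (A *\<^sub>v (pinv A *\<^sub>v y)) = transpose_mat A *\<^sub>v y"
proof -
  let ?X = "pinv A"
  have mp: "is_moore_penrose A ?X" by (rule is_moore_penrose_pinv[OF A inj])
  then have X: "?X \<in> carrier_mat d n" using A by (simp add: is_moore_penrose_def)
  show "?X *\<^sub>v y \<in> carrier_vec d" using X y by simp
  have tA: "transpose_mat A \<in> carrier_mat d n" and AX: "A * ?X \<in> carrier_mat n n"
    using A X by auto
  have "transpose_mat A * (A * ?X) = transpose_mat (A * ?X * A)"
    using transpose_mult[OF AX A] mp by (simp add: is_moore_penrose_def)
  also have "\<dots> = transpose_mat A" using mp by (simp add: is_moore_penrose_def)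
  finally have "transpose_mat A * (A * ?X) *\<^sub>v y = transpose_mat A *\<^sub>v y" by simp
  then show "transpose_mat A *\<^sub>v (A *\<^sub>v (?X *\<^sub>v y)) = transpose_mat A *\<^sub>v y"
    using assoc_mult_mat_vec[OF tA AX y] assoc_mult_mat_vec[OF A X y] by simp
qed

section \<open>Norm bounds from extremal eigenvalues and singular values\<close>

text \<open>\<open>rayleigh_max\<close> yields some eigenvalue bounding the quadratic form, and the
  maximum of the finite spectrum is at least that eigenvalue.\<close>

lemma gram_upper:
  fixes B :: "real mat"
  assumes B: "B \<in> carrier_mat n k" and k: "k > 0" and v: "v \<in> carrier_vec k"
  shows "(B *\<^sub>v v) \<bullet> (B *\<^sub>v v) \<le> lambda_max (transpose_mat B * B) * (v \<bullet> v)"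
proof -
  let ?G = "transpose_mat B * B"
  have G: "?G \<in> carrier_mat k k" using B by auto
  obtain m where m: "m \<in> spectrum ?G"
    "\<And>v. v \<in> carrier_vec k \<Longrightarrow> v \<bullet> (?G *\<^sub>v v) \<le> m * (v \<bullet> v)"
    using rayleigh_max[OF G transpose_gram k] by blast
  have "m \<le> lambda_max ?G"
    unfolding lambda_max_def by (intro Max_ge m(1) card_finite_spectrum[OF G])
  then show ?thesis
    using m(2)[OF v] gram_sprod[OF B v] mult_right_mono[OF _ sprod_self_nonneg[of v]]
    by (metis order_trans)
qed

lemma singular_value_bounds:
  fixes A :: "real mat"
  assumes A: "A \<in> carrier_mat n d" and d: "d > 0"
    and inj: "\<And>v. v \<in> carrier_vec d \<Longrightarrow> A *\<^sub>v v = 0\<^sub>v n \<Longrightarrow> v = 0\<^sub>v d"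
  shows "sigma_min A > 0"
    "\<And>v. v \<in> carrier_vec d \<Longrightarrow> (sigma_min A)\<^sup>2 * (v \<bullet> v) \<le> (A *\<^sub>v v) \<bullet> (A *\<^sub>v v)"
    "\<And>v. v \<in> carrier_vec d \<Longrightarrow> (A *\<^sub>v v) \<bullet> (A *\<^sub>v v) \<le> (sigma_max A)\<^sup>2 * (v \<bullet> v)"
proof -
  let ?G = "transpose_mat A * A"
  have G: "?G \<in> carrier_mat d d" using A by auto
  have pos: "e > 0" if "e \<in> spectrum ?G" for e
  proof -
    from that G obtain v where v: "v \<in> carrier_vec d" "v \<noteq> 0\<^sub>v d" "?G *\<^sub>v v = e \<cdot>\<^sub>v v"
      by (auto simp: spectrum_def eigenvalue_def eigenvector_def)
    have "(A *\<^sub>v v) \<bullet> (A *\<^sub>v v) = e * (v \<bullet> v)"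
      using gram_sprod[OF A v(1)] v(1) by (simp add: v(3))
    moreover have "v \<bullet> v > 0"
      using sprod_self_eq_0_iff[OF v(1)] v(2) sprod_self_nonneg[of v] by simp
    moreover have "(A *\<^sub>v v) \<bullet> (A *\<^sub>v v) > 0"
      using sprod_self_eq_0_iff[of "A *\<^sub>v v" n] inj[OF v(1)] v(1,2) A
        sprod_self_nonneg[of "A *\<^sub>v v"] by fastforce
    ultimately show ?thesis by (metis zero_less_mult_pos2)
  qed
  obtain m where m: "m \<in> spectrum ?G"
    "\<And>v. v \<in> carrier_vec d \<Longrightarrow> m * (v \<bullet> v) \<le> v \<bullet> (?G *\<^sub>v v)"
    using rayleigh_min[OF G transpose_gram d] by blast
  obtain M where M: "M \<in> spectrum ?G"
    "\<And>v. v \<in> carrier_vec d \<Longrightarrow> v \<bullet> (?G *\<^sub>v v) \<le> M * (v \<bullet> v)"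
    using rayleigh_max[OF G transpose_gram d] by blast
  have fin: "finite (singular_values A)"
    unfolding singular_values_def using card_finite_spectrum(1)[OF G] by simp
  \<comment> \<open>By injectivity 0 is not an eigenvalue of the Gram matrix, so the smallest
    nonzero singular value is the smallest one.\<close>
  have sv: "singular_values A - {0} = singular_values A"
    using pos by (fastforce simp: singular_values_def)
  have "sigma_min A \<in> singular_values A"
    unfolding sigma_min_def sv using fin m(1) by (intro Min_in) (auto simp: singular_values_def)
  then show smin: "sigma_min A > 0" using pos by (auto simp: singular_values_def)
  have "sigma_min A \<le> sqrt m"
    unfolding sigma_min_def sv using fin m(1) by (intro Min_le) (auto simp: singular_values_def)
  then have "(sigma_min A)\<^sup>2 \<le> m"
    using smin pos[OF m(1)] power_mono[of "sigma_min A" "sqrt m" 2] by simp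
  then show "(sigma_min A)\<^sup>2 * (v \<bullet> v) \<le> (A *\<^sub>v v) \<bullet> (A *\<^sub>v v)" if v: "v \<in> carrier_vec d" for v
    using m(2)[OF v] gram_sprod[OF A v] mult_right_mono[OF _ sprod_self_nonneg[of v]]
    by (metis order_trans)
  have "sqrt M \<le> sigma_max A"
    unfolding sigma_max_def using fin M(1) by (intro Max_ge) (auto simp: singular_values_def)
  then have "M \<le> (sigma_max A)\<^sup>2"
    using pos[OF M(1)] power_mono[of "sqrt M" "sigma_max A" 2] by simp
  then show "(A *\<^sub>v v) \<bullet> (A *\<^sub>v v) \<le> (sigma_max A)\<^sup>2 * (v \<bullet> v)" if v: "v \<in> carrier_vec d" for v
    using M(2)[OF v] gram_sprod[OF A v] mult_right_mono[OF _ sprod_self_nonneg[of v]]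
    by (metis order_trans)
qed

text \<open>A matrix and its transpose share their operator norm: for u = B^T y, |u|^2 = y . B u is
  at most |y| sqrt(c) |u|, and |u| cancels.\<close>

lemma transpose_mult_vec_upper:
  fixes B :: "real mat"
  assumes B: "B \<in> carrier_mat n k" and c: "c \<ge> 0"
    and le: "\<And>v. v \<in> carrier_vec k \<Longrightarrow> (B *\<^sub>v v) \<bullet> (B *\<^sub>v v) \<le> c * (v \<bullet> v)"
    and y: "y \<in> carrier_vec n"
  shows "(transpose_mat B *\<^sub>v y) \<bullet> (transpose_mat B *\<^sub>v y) \<le> c * (y \<bullet> y)"
proof -
  define u where "u = transpose_mat B *\<^sub>v y"
  have u: "u \<in> carrier_vec k" using B y by (simp add: u_def)
  have "u \<bullet> u = y \<bullet> (B *\<^sub>v u)"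
    unfolding u_def using u transpose_vec_mult_scalar[OF B _ y] by (simp add: u_def)
  then have "(u \<bullet> u)\<^sup>2 \<le> (y \<bullet> y) * ((B *\<^sub>v u) \<bullet> (B *\<^sub>v u))"
    using sprod_Cauchy_Schwarz[of y n "B *\<^sub>v u"] B u y by simp
  also have "\<dots> \<le> (y \<bullet> y) * (c * (u \<bullet> u))"
    by (intro mult_left_mono le u sprod_self_nonneg)
  finally have "(u \<bullet> u) * (u \<bullet> u) \<le> (c * (y \<bullet> y)) * (u \<bullet> u)"
    by (simp add: power2_eq_square ac_simps)
  then have "u \<bullet> u \<le> c * (y \<bullet> y)"
    using c sprod_self_nonneg[of u] sprod_self_nonneg[of y]
    by (cases "u \<bullet> u = 0") (auto simp: mult_le_cancel_right)
  then show ?thesis by (simp add: u_def)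
qed

text \<open>For y = A v and u = A^T y, |y|^2 = u . v is at most |u| |v|, and sqrt(c) |v| is at most
  |y|; then |y| cancels. The argument rests on \<open>y\<close> lying in the range of
  \<open>A\<close>.\<close>

lemma transpose_mult_vec_lower:
  fixes A :: "real mat"
  assumes A: "A \<in> carrier_mat n d" and c: "c \<ge> 0"
    and le: "\<And>v. v \<in> carrier_vec d \<Longrightarrow> c * (v \<bullet> v) \<le> (A *\<^sub>v v) \<bullet> (A *\<^sub>v v)"
    and v: "v \<in> carrier_vec d" and y: "y = A *\<^sub>v v"
  shows "c * (y \<bullet> y) \<le> (transpose_mat A *\<^sub>v y) \<bullet> (transpose_mat A *\<^sub>v y)"
proof -
  define u where "u = transpose_mat A *\<^sub>v y"
  have cy: "y \<in> carrier_vec n" using A v y by simp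
  have u: "u \<in> carrier_vec d" using A cy by (simp add: u_def)
  have "y \<bullet> y = u \<bullet> v"
    unfolding u_def transpose_vec_mult_scalar[OF A v cy] by (simp add: y)
  then have "c * (y \<bullet> y)\<^sup>2 \<le> c * ((u \<bullet> u) * (v \<bullet> v))"
    using sprod_Cauchy_Schwarz[OF u v] c by (simp add: mult_left_mono)
  also have "\<dots> = (u \<bullet> u) * (c * (v \<bullet> v))" by simp
  also have "\<dots> \<le> (u \<bullet> u) * (y \<bullet> y)"
    unfolding y by (intro mult_left_mono le v sprod_self_nonneg)
  finally have "(c * (y \<bullet> y)) * (y \<bullet> y) \<le> (u \<bullet> u) * (y \<bullet> y)"
    by (simp add: power2_eq_square ac_simps)
  then have "c * (y \<bullet> y) \<le> u \<bullet> u"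
    using sprod_self_nonneg[of u] sprod_self_nonneg[of y]
    by (cases "y \<bullet> y = 0") (auto simp: mult_le_cancel_right)
  then show ?thesis by (simp add: u_def)
qed

section \<open>Column submatrices and block updates\<close>

lemma bij_betw_pick:
  assumes "finite \<tau>"
  shows "bij_betw (pick \<tau>) {..<card \<tau>} \<tau>"
proof (rule bij_betw_byWitness[where f' = "\<lambda>j. card {a \<in> \<tau>. a < j}"])
  show "\<forall>l\<in>{..<card \<tau>}. card {a \<in> \<tau>. a < pick \<tau> l} = l" by (simp add: card_pick_le)
  show "\<forall>j\<in>\<tau>. pick \<tau> (card {a \<in> \<tau>. a < j}) = j" by (simp add: pick_card_in_set)
  show "pick \<tau> ` {..<card \<tau>} \<subseteq> \<tau>" by (auto simp: pick_in_set_le)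
  show "(\<lambda>j. card {a \<in> \<tau>. a < j}) ` \<tau> \<subseteq> {..<card \<tau>}"
    using assms by (auto intro!: psubset_card_mono)
qed

lemma col_submatrix_index:
  assumes "A \<in> carrier_mat n d" "\<tau> \<subseteq> {0..<d}"
  shows "col_submatrix A \<tau> \<in> carrier_mat n (card \<tau>)"
    "\<And>i l. i < n \<Longrightarrow> l < card \<tau> \<Longrightarrow> col_submatrix A \<tau> $$ (i, l) = A $$ (i, pick \<tau> l)"
proof -
  have eq: "{j. j < dim_col A \<and> j \<in> \<tau>} = \<tau>" "{i. i < dim_row A \<and> i \<in> UNIV} = {..<n}"
    using assms by auto
  show "col_submatrix A \<tau> \<in> carrier_mat n (card \<tau>)"
    unfolding col_submatrix_def by (rule carrier_matI) (simp_all only: dim_submatrix eq card_lessThan)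
  fix i l assume "i < n" "l < card \<tau>"
  then show "col_submatrix A \<tau> $$ (i, l) = A $$ (i, pick \<tau> l)"
    unfolding col_submatrix_def by (subst submatrix_index) (simp_all only: eq card_lessThan pick_UNIV)
qed

text \<open>\<open>block_add \<tau> (0\<^sub>v d) w\<close> is \<open>w\<close> padded by zeros
  outside the block. This links the update of \<open>x\<close> with that of \<open>z\<close>: both
  express the same change of \<open>A *\<^sub>v x\<close>.\<close>

lemma col_submatrix_mult_vec:
  assumes A: "A \<in> carrier_mat n d" and \<tau>: "\<tau> \<subseteq> {0..<d}" and w: "w \<in> carrier_vec (card \<tau>)"
  shows "col_submatrix A \<tau> *\<^sub>v w = A *\<^sub>v block_add \<tau> (0\<^sub>v d) w"
proof (rule eq_vecI)
  note sub = col_submatrix_index[OF A \<tau>]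
  show "dim_vec (col_submatrix A \<tau> *\<^sub>v w) = dim_vec (A *\<^sub>v block_add \<tau> (0\<^sub>v d) w)"
    using A sub(1) by simp
  fix i assume "i < dim_vec (A *\<^sub>v block_add \<tau> (0\<^sub>v d) w)"
  then have i: "i < n" using A by simp
  have fin: "finite \<tau>" using \<tau> finite_subset by blast
  let ?w = "\<lambda>j. w $ card {a \<in> \<tau>. a < j}"
  have "(A *\<^sub>v block_add \<tau> (0\<^sub>v d) w) $ i = (\<Sum>j\<in>{0..<d}. A $$ (i, j) * (if j \<in> \<tau> then ?w j else 0))"
    using A i \<tau> by (auto simp: scalar_prod_def block_add_def intro!: sum.cong)
  also have "\<dots> = (\<Sum>j\<in>\<tau>. A $$ (i, j) * ?w j)"
    using \<tau> by (intro sum.mono_neutral_cong_right) auto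
  also have "\<dots> = (\<Sum>l<card \<tau>. A $$ (i, pick \<tau> l) * ?w (pick \<tau> l))"
    by (rule sum.reindex_bij_betw[OF bij_betw_pick[OF fin], symmetric])
  also have "\<dots> = (\<Sum>l<card \<tau>. col_submatrix A \<tau> $$ (i, l) * w $ l)"
    using sub(2) i by (intro sum.cong) (auto simp: card_pick_le)
  also have "\<dots> = (col_submatrix A \<tau> *\<^sub>v w) $ i"
    using sub(1) i w by (auto simp: scalar_prod_def lessThan_atLeast0 intro!: sum.cong)
  finally show "(col_submatrix A \<tau> *\<^sub>v w) $ i = (A *\<^sub>v block_add \<tau> (0\<^sub>v d) w) $ i" by simp
qed

lemma transpose_col_submatrix_mult_vec:
  assumes A: "A \<in> carrier_mat n d" and \<tau>: "\<tau> \<subseteq> {0..<d}" and y: "y \<in> carrier_vec n"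
  shows "transpose_mat (col_submatrix A \<tau>) *\<^sub>v y
    = vec (card \<tau>) (\<lambda>l. (transpose_mat A *\<^sub>v y) $ pick \<tau> l)"
proof (rule eq_vecI)
  note sub = col_submatrix_index[OF A \<tau>]
  fix l assume "l < dim_vec (vec (card \<tau>) (\<lambda>l. (transpose_mat A *\<^sub>v y) $ pick \<tau> l))"
  then have l: "l < card \<tau>" by simp
  then have "pick \<tau> l < d" using pick_in_set_le[OF l] \<tau> by auto
  then show "(transpose_mat (col_submatrix A \<tau>) *\<^sub>v y) $ l
      = vec (card \<tau>) (\<lambda>l. (transpose_mat A *\<^sub>v y) $ pick \<tau> l) $ l"
    using A y l sub by (auto simp: scalar_prod_def intro!: sum.cong)
qed (use col_submatrix_index(1)[OF A \<tau>] in simp)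

text \<open>The blocks partition the coordinates of A^T y, so each squared coordinate is counted in
  exactly one block.\<close>

lemma sum_transpose_col_submatrix:
  fixes A :: "real mat"
  assumes A: "A \<in> carrier_mat n d" and P: "partition_on {0..<d} P" and y: "y \<in> carrier_vec n"
  shows "(\<Sum>\<tau>\<in>P. (transpose_mat (col_submatrix A \<tau>) *\<^sub>v y) \<bullet> (transpose_mat (col_submatrix A \<tau>) *\<^sub>v y))
    = (transpose_mat A *\<^sub>v y) \<bullet> (transpose_mat A *\<^sub>v y)"
proof -
  define g where "g j = (transpose_mat A *\<^sub>v y) $ j * (transpose_mat A *\<^sub>v y) $ j" for j
  have sub: "\<tau> \<subseteq> {0..<d}" if "\<tau> \<in> P" for \<tau>
    using that partition_onD1[OF P] by blast
  then have fin: "finite \<tau>" if "\<tau> \<in> P" for \<tau>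
    using that finite_subset by blast
  have "(\<Sum>\<tau>\<in>P. (transpose_mat (col_submatrix A \<tau>) *\<^sub>v y) \<bullet> (transpose_mat (col_submatrix A \<tau>) *\<^sub>v y))
      = (\<Sum>\<tau>\<in>P. sum g \<tau>)"
  proof (rule sum.cong[OF refl])
    fix \<tau> assume "\<tau> \<in> P"
    note \<tau> = sub[OF this] fin[OF this]
    show "(transpose_mat (col_submatrix A \<tau>) *\<^sub>v y) \<bullet> (transpose_mat (col_submatrix A \<tau>) *\<^sub>v y) = sum g \<tau>"
      unfolding transpose_col_submatrix_mult_vec[OF A \<tau>(1) y]
      using sum.reindex_bij_betw[OF bij_betw_pick[OF \<tau>(2)], of g]
      by (simp add: scalar_prod_def g_def lessThan_atLeast0)
  qed
  also have "\<dots> = sum g (\<Union>P)"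
    using fin partition_onD2[OF P]
    by (subst sum.Union_disjoint) (auto simp: disjoint_def)
  also have "\<dots> = (transpose_mat A *\<^sub>v y) \<bullet> (transpose_mat A *\<^sub>v y)"
    using A by (simp add: partition_onD1[OF P, symmetric] scalar_prod_def g_def)
  finally show ?thesis .
qed

lemma block_add_carrier: "x \<in> carrier_vec d \<Longrightarrow> block_add \<tau> x w \<in> carrier_vec d"
  by (rule carrier_vecI) (simp add: block_add_def)

lemma block_add_eq_add:
  assumes "x \<in> carrier_vec d"
  shows "block_add \<tau> x w = x + block_add \<tau> (0\<^sub>v d) w"
proof (rule eq_vecI)
  fix j assume "j < dim_vec (x + block_add \<tau> (0\<^sub>v d) w)"
  then have "j < d" by (simp add: block_add_def)
  then show "block_add \<tau> x w $ j = (x + block_add \<tau> (0\<^sub>v d) w) $ j"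
    using carrier_vecD[OF assms] by (simp add: block_add_def)
qed (use carrier_vecD[OF assms] in \<open>simp add: block_add_def\<close>)

section \<open>Injectivity from full column rank\<close>

text \<open>The zero-padded \<open>w\<close> lies in the kernel of \<open>A\<close>, hence vanishes,
  and its entries at \<open>pick \<tau> l\<close> are those of \<open>w\<close>.\<close>

lemma col_submatrix_injective:
  assumes A: "A \<in> carrier_mat n d" and \<tau>: "\<tau> \<subseteq> {0..<d}"
    and inj: "\<And>v. v \<in> carrier_vec d \<Longrightarrow> A *\<^sub>v v = 0\<^sub>v n \<Longrightarrow> v = 0\<^sub>v d"
    and w: "w \<in> carrier_vec (card \<tau>)" and 0: "col_submatrix A \<tau> *\<^sub>v w = 0\<^sub>v n"
  shows "w = 0\<^sub>v (card \<tau>)"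
proof (rule eq_vecI)
  have z: "block_add \<tau> (0\<^sub>v d) w = 0\<^sub>v d"
    by (rule inj[OF block_add_carrier]) (use 0 col_submatrix_mult_vec[OF A \<tau> w] in simp_all)
  fix l assume "l < dim_vec (0\<^sub>v (card \<tau>) :: real vec)"
  then have l: "l < card \<tau>" by simp
  then have "pick \<tau> l < d" using pick_in_set_le[OF l] \<tau> by auto
  then show "w $ l = 0\<^sub>v (card \<tau>) $ l"
    using block_add_pick[of \<tau> "0\<^sub>v d" l w] \<tau> l by (simp add: z)
qed (use w in simp)

lemma (in vec_space) full_rank_injective:
  assumes A: "A \<in> carrier_mat n nc" and r: "rank A = nc"
    and v: "v \<in> carrier_vec nc" "A *\<^sub>v v = 0\<^sub>v n"
  shows "v = 0\<^sub>v nc"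
proof -
  \<comment> \<open>Linear independence concerns the set of columns and controls the kernel only if
    no column is repeated. With a repetition there are fewer than \<open>nc\<close> distinct
    columns, and the rank, the size of a maximal independent subset, would be too small.\<close>
  have "distinct (cols A)"
  proof (rule ccontr)
    assume nd: "\<not> distinct (cols A)"
    obtain S where S: "maximal S (\<lambda>T. T \<subseteq> set (cols A) \<and> lin_indpt T)"
      using maximal_exists[of "(\<lambda>T. T \<subseteq> set (cols A) \<and> lin_indpt T)" "card (set (cols A))" "{}"]
      by (meson List.finite_set card_mono empty_iff empty_subsetI finite_lin_indpt2 rev_finite_subset)
    then have "card S \<le> card (set (cols A))" by (simp add: card_mono maximal_def)
    also have "\<dots> < length (cols A)"
      using nd card_distinct card_length by (metis le_neq_implies_less)
    finally show False using rank_card_indpt[OF A S] r A by simp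
  qed
  then show ?thesis using lin_depI[OF A v(1) _ v(2)] full_rank_lin_indpt[OF A r] by blast
qed

section \<open>Decrease of the error in one step\<close>

lemma sprod_diff_self:
  fixes u :: "real vec"
  assumes "u \<in> carrier_vec n" "v \<in> carrier_vec n"
  shows "(u - v) \<bullet> (u - v) = u \<bullet> u - 2 * (u \<bullet> v) + v \<bullet> v"
  using assms
  by (simp add: minus_scalar_prod_distrib[of _ n] scalar_prod_minus_distrib[of _ n]
      comm_scalar_prod[of v n u])

text \<open>By Pythagoras the squared error decreases by exactly \<open>|u|\<^sup>2\<close>, where \<open>u = A\<^sub>\<tau> w\<close> satisfies
  \<open>A\<^sub>\<tau>\<^sup>T u = A\<^sub>\<tau>\<^sup>T y\<close>, and \<open>|A\<^sub>\<tau>\<^sup>T u|\<^sup>2 \<le> \<beta> |u|\<^sup>2\<close>.\<close>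

lemma rbls_step_decrease:
  fixes A :: "real mat"
  assumes A: "A \<in> carrier_mat n d"
    and inj: "\<And>v. v \<in> carrier_vec d \<Longrightarrow> A *\<^sub>v v = 0\<^sub>v n \<Longrightarrow> v = 0\<^sub>v d"
    and b: "b \<in> carrier_vec n"
    and \<tau>: "\<tau> \<subseteq> {0..<d}" and \<tau>_ne: "\<tau> \<noteq> {}"
    and \<beta>: "lambda_max (transpose_mat (col_submatrix A \<tau>) * col_submatrix A \<tau>) \<le> \<beta>"
    and xs: "xs \<in> carrier_vec d" "transpose_mat A *\<^sub>v (A *\<^sub>v xs) = transpose_mat A *\<^sub>v b"
    and x: "x \<in> carrier_vec d"
  defines "y \<equiv> A *\<^sub>v (xs - x)"
  shows "\<beta> > 0"
    "\<exists>x'\<in>carrier_vec d. rbls_step A \<tau> (x, b - A *\<^sub>v x) = (x', b - A *\<^sub>v x') \<and>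
      \<beta> * ((A *\<^sub>v (xs - x')) \<bullet> (A *\<^sub>v (xs - x')))
        + (transpose_mat (col_submatrix A \<tau>) *\<^sub>v y) \<bullet> (transpose_mat (col_submatrix A \<tau>) *\<^sub>v y)
      \<le> \<beta> * (y \<bullet> y)"
proof -
  define k where "k = card \<tau>"
  define B where "B = col_submatrix A \<tau>"
  have tA: "transpose_mat A \<in> carrier_mat d n" using A by simp
  have k: "k > 0" using \<tau> \<tau>_ne finite_subset by (auto simp: k_def card_gt_0_iff)
  have B: "B \<in> carrier_mat n k" unfolding B_def k_def by (rule col_submatrix_index(1)[OF A \<tau>])
  then have tB: "transpose_mat B \<in> carrier_mat k n" by simp
  have injB: "w = 0\<^sub>v k" if "w \<in> carrier_vec k" "B *\<^sub>v w = 0\<^sub>v n" for w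
    using col_submatrix_injective[OF A \<tau> inj] that by (simp add: k_def B_def)
  have up: "(B *\<^sub>v v) \<bullet> (B *\<^sub>v v) \<le> \<beta> * (v \<bullet> v)" if "v \<in> carrier_vec k" for v
    using gram_upper[OF B k that] mult_right_mono[OF \<beta> sprod_self_nonneg[of v]]
    by (simp add: B_def)
  \<comment> \<open>A unit vector witnesses positivity: |B e|^2 is nonzero by injectivity and at
    most \<open>\<beta>\<close>.\<close>
  define e where "e = (unit_vec k 0 :: real vec)"
  have e: "e \<in> carrier_vec k" "e \<bullet> e = 1" using k by (simp_all add: e_def)
  then have "e \<noteq> 0\<^sub>v k" by auto
  then have "B *\<^sub>v e \<noteq> 0\<^sub>v n" using injB e(1) by blast
  then have "(B *\<^sub>v e) \<bullet> (B *\<^sub>v e) \<noteq> 0"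
    using sprod_self_eq_0_iff[of "B *\<^sub>v e" n] B e(1) by simp
  then show \<beta>_pos: "\<beta> > 0"
    using up[OF e(1)] e(2) sprod_self_nonneg[of "B *\<^sub>v e"] by simp
  define z where "z = b - A *\<^sub>v x"
  have Ax: "A *\<^sub>v x \<in> carrier_vec n" "A *\<^sub>v xs \<in> carrier_vec n" using A x xs by auto
  have z: "z \<in> carrier_vec n" using b Ax by (simp add: z_def)
  have y: "y \<in> carrier_vec n" "y = A *\<^sub>v xs - A *\<^sub>v x"
    using A x xs mult_minus_distrib_mat_vec[OF A xs(1) x] by (auto simp: y_def)
  \<comment> \<open>\<open>z\<close> and \<open>y\<close> differ by the least squares residual
    \<open>b - A *\<^sub>v xs\<close>, which A^T annihilates; the step therefore acts on the unknown
    \<open>y\<close> through the known \<open>z\<close>.\<close>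
  have "transpose_mat A *\<^sub>v z = transpose_mat A *\<^sub>v y"
    unfolding y(2) z_def
    using mult_minus_distrib_mat_vec[OF tA b Ax(1)] mult_minus_distrib_mat_vec[OF tA Ax(2,1)] xs(2)
    by simp
  then have Bzy: "transpose_mat B *\<^sub>v z = transpose_mat B *\<^sub>v y"
    unfolding B_def
    by (simp add: transpose_col_submatrix_mult_vec[OF A \<tau> z] transpose_col_submatrix_mult_vec[OF A \<tau> y(1)])
  define w where "w = pinv B *\<^sub>v z"
  have w: "w \<in> carrier_vec k" unfolding w_def by (rule pinv_normal_equations(1)[OF B injB z])
  define u where "u = B *\<^sub>v w"
  have u: "u \<in> carrier_vec n" using B w by (simp add: u_def)
  have Bu: "transpose_mat B *\<^sub>v u = transpose_mat B *\<^sub>v y"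
    unfolding u_def w_def Bzy[symmetric] by (rule pinv_normal_equations(2)[OF B injB z])
  define x' where "x' = block_add \<tau> x w"
  have x': "x' \<in> carrier_vec d" unfolding x'_def by (rule block_add_carrier[OF x])
  define h where "h = block_add \<tau> (0\<^sub>v d) w"
  have h: "h \<in> carrier_vec d" unfolding h_def by (rule block_add_carrier) simp
  have "A *\<^sub>v h = u"
    using col_submatrix_mult_vec[OF A \<tau>] w by (simp add: u_def B_def h_def k_def)
  then have Ax': "A *\<^sub>v x' = A *\<^sub>v x + u"
    unfolding x'_def block_add_eq_add[OF x] h_def[symmetric]
    using mult_add_distrib_mat_vec[OF A x h] by simp
  have "z - u = b - A *\<^sub>v x'"
    unfolding z_def Ax' using A b u by (intro eq_vecI) auto
  then have step: "rbls_step A \<tau> (x, b - A *\<^sub>v x) = (x', b - A *\<^sub>v x')"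
    by (simp add: rbls_step_def Let_def x'_def w_def u_def B_def z_def)
  have err: "A *\<^sub>v (xs - x') = y - u"
    unfolding mult_minus_distrib_mat_vec[OF A xs(1) x'] y(2) Ax' using A u by (intro eq_vecI) auto
  \<comment> \<open>By the block normal equations \<open>y - u\<close> is orthogonal to the range of
    \<open>B\<close>, so \<open>u\<close> is the orthogonal projection of \<open>y\<close>.\<close>
  have "(y - u) \<bullet> u = (transpose_mat B *\<^sub>v (y - u)) \<bullet> w"
    unfolding u_def using transpose_vec_mult_scalar[OF B w, of "y - u"] y(1) u by (simp add: u_def)
  also have "transpose_mat B *\<^sub>v (y - u) = 0\<^sub>v k"
    using mult_minus_distrib_mat_vec[OF tB y(1) u] Bu tB y(1) by simp
  finally have "y \<bullet> u = u \<bullet> u"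
    using w y(1) u by (simp add: minus_scalar_prod_distrib[of _ n])
  then have "(y - u) \<bullet> (y - u) = y \<bullet> y - u \<bullet> u"
    using sprod_diff_self[OF y(1) u] by simp
  moreover have "(transpose_mat B *\<^sub>v u) \<bullet> (transpose_mat B *\<^sub>v u) \<le> \<beta> * (u \<bullet> u)"
    using transpose_mult_vec_upper[OF B _ up u] \<beta>_pos by simp
  ultimately have "\<beta> * ((y - u) \<bullet> (y - u))
      + (transpose_mat B *\<^sub>v y) \<bullet> (transpose_mat B *\<^sub>v y) \<le> \<beta> * (y \<bullet> y)"
    by (simp add: Bu right_diff_distrib)
  then show "\<exists>x'\<in>carrier_vec d. rbls_step A \<tau> (x, b - A *\<^sub>v x) = (x', b - A *\<^sub>v x') \<and>
      \<beta> * ((A *\<^sub>v (xs - x')) \<bullet> (A *\<^sub>v (xs - x')))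
        + (transpose_mat (col_submatrix A \<tau>) *\<^sub>v y) \<bullet> (transpose_mat (col_submatrix A \<tau>) *\<^sub>v y)
      \<le> \<beta> * (y \<bullet> y)"
    using x' step by (intro bexI[of _ x']) (simp_all add: err B_def[symmetric])
qed

section \<open>The random iteration and the expected error\<close>

text \<open>\<open>block_add\<close> keeps the dimension whatever block is drawn; this settles the
  case \<open>d = 0\<close>, where the distribution of the block is unspecified.\<close>

lemma rbls_state_dim:
  "s \<in> set_pmf (rbls_state A b P k) \<Longrightarrow> fst s \<in> carrier_vec (dim_col A)"
  by (induction k arbitrary: s)
    (auto simp: rbls_step_def Let_def split_beta intro!: block_add_carrier)

text \<open>The second component always is the residual of the first, so the error depends on
  \<open>x\<close> alone. Finite support turns expectations into finite sums and provides
  integrability.\<close>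

lemma rbls_state_residual:
  assumes A: "A \<in> carrier_mat n d" and b: "b \<in> carrier_vec n"
    and P: "finite P" "P \<noteq> {}"
    and step: "\<And>\<tau> x. \<tau> \<in> P \<Longrightarrow> x \<in> carrier_vec d \<Longrightarrow>
      \<exists>x'\<in>carrier_vec d. rbls_step A \<tau> (x, b - A *\<^sub>v x) = (x', b - A *\<^sub>v x')"
  shows "finite (set_pmf (rbls_state A b P k)) \<and>
    (\<forall>s\<in>set_pmf (rbls_state A b P k). \<exists>x\<in>carrier_vec d. s = (x, b - A *\<^sub>v x))"
proof (induction k)
  case 0
  have "b = b - A *\<^sub>v 0\<^sub>v d" using A b by (intro eq_vecI) auto
  then show ?case using A by auto
next
  case (Suc k)
  then show ?case using P by (auto dest!: step)
qed

theorem corollary8: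
  fixes A :: "real mat" and b :: "real vec" and n d T p :: nat
    and \<alpha> \<beta> :: real and P :: "nat set set"
  assumes "A \<in> carrier_mat n d"
    and "vec_space.rank n A = d"
    and "b \<in> carrier_vec n"
    and "column_paving A p \<alpha> \<beta> P"
  shows "measure_pmf.expectation (rbls_output A b P T) (\<lambda>x. (norm2 (x_LS A b - x))\<^sup>2)
           \<le> (1 - (sigma_min A)\<^sup>2 / (real p * \<beta>)) ^ T * (kappa A)\<^sup>2 * (norm2 (x_LS A b))\<^sup>2"
proof (cases "d = 0")
  case True
  \<comment> \<open>Here \<open>P = {}\<close>, so \<open>pmf_of_set P\<close> is unspecified, but all iterates have dimension 0.\<close>
  have "(norm2 (x_LS A b - fst s))\<^sup>2 = 0" if "s \<in> set_pmf (rbls_state A b P T)" for s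
    using rbls_state_dim[OF that] assms(1) True by (simp add: norm2_square scalar_prod_def)
  then have "measure_pmf.expectation (rbls_state A b P T) (\<lambda>s. (norm2 (x_LS A b - fst s))\<^sup>2)
      = measure_pmf.expectation (rbls_state A b P T) (\<lambda>s. 0)"
    by (intro integral_cong_AE) (auto simp: AE_measure_pmf_iff)
  moreover have "x_LS A b \<in> carrier_vec 0"
    unfolding x_LS_def
    by (rule pinv_normal_equations(1)[OF assms(1) _ assms(3), unfolded True]) auto
  then have "norm2 (x_LS A b) = 0" by (simp add: norm2_def scalar_prod_def)
  ultimately show ?thesis by (simp add: rbls_output_def)
next
  case False
  then have d: "d > 0" by simp
  note A = assms(1) and b = assms(3)
  have inj: "v = 0\<^sub>v d" if "v \<in> carrier_vec d" "A *\<^sub>v v = 0\<^sub>v n" for v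
    using vec_space.full_rank_injective[OF A assms(2) that] .
  have part: "partition_on {0..<d} P" and p: "card P = p"
    and \<beta>: "\<And>\<tau>. \<tau> \<in> P \<Longrightarrow> lambda_max (transpose_mat (col_submatrix A \<tau>) * col_submatrix A \<tau>) \<le> \<beta>"
    using assms(4) A by (auto simp: column_paving_def)
  have sub: "\<tau> \<subseteq> {0..<d}" "\<tau> \<noteq> {}" if "\<tau> \<in> P" for \<tau>
    using that partition_onD1[OF part] partition_onD3[OF part] by auto
  have P: "finite P" "P \<noteq> {}"
    using finite_elements[OF finite_atLeastLessThan part] partition_onD1[OF part] d by auto
  then have p_pos: "p > 0" using p by (auto simp: card_gt_0_iff)
  define xs where "xs = x_LS A b"
  have xs: "xs \<in> carrier_vec d" "transpose_mat A *\<^sub>v (A *\<^sub>v xs) = transpose_mat A *\<^sub>v b"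
    unfolding xs_def x_LS_def by (rule pinv_normal_equations[OF A inj b]; assumption)+
  note step = rbls_step_decrease[OF A inj b sub \<beta> xs]
  obtain \<tau>0 where "\<tau>0 \<in> P" using P by blast
  then have \<beta>_pos: "\<beta> > 0" using step(1)[OF _ _ _ _ _ xs(1)] by blast
  have sv: "sigma_min A > 0"
    "v \<in> carrier_vec d \<Longrightarrow> (sigma_min A)\<^sup>2 * (v \<bullet> v) \<le> (A *\<^sub>v v) \<bullet> (A *\<^sub>v v)"
    "v \<in> carrier_vec d \<Longrightarrow> (A *\<^sub>v v) \<bullet> (A *\<^sub>v v) \<le> (sigma_max A)\<^sup>2 * (v \<bullet> v)" for v
    by (rule singular_value_bounds[OF A d inj]; assumption)+
  define \<sigma> where "\<sigma> = (sigma_min A)\<^sup>2"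
  have \<sigma>: "\<sigma> > 0" using sv(1) by (simp add: \<sigma>_def)
  define c where "c = 1 - \<sigma> / (real p * \<beta>)"
  define F where "F x = (A *\<^sub>v (xs - x)) \<bullet> (A *\<^sub>v (xs - x))" for x
  have inv: "finite (set_pmf (rbls_state A b P k))"
    "s \<in> set_pmf (rbls_state A b P k) \<Longrightarrow> \<exists>x\<in>carrier_vec d. s = (x, b - A *\<^sub>v x)" for k s
    using rbls_state_residual[OF A b P] step(2) by blast+
  have avg: "(\<Sum>\<tau>\<in>P. F (fst (rbls_step A \<tau> (x, b - A *\<^sub>v x)))) / p \<le> c * F x"
    if x: "x \<in> carrier_vec d" for x
  proof -
    define y where "y = A *\<^sub>v (xs - x)"
    have y: "y \<in> carrier_vec n" and v: "xs - x \<in> carrier_vec d" using A x xs by (auto simp: y_def)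
    let ?g = "\<lambda>\<tau>. (transpose_mat (col_submatrix A \<tau>) *\<^sub>v y) \<bullet> (transpose_mat (col_submatrix A \<tau>) *\<^sub>v y)"
    have "\<beta> * F (fst (rbls_step A \<tau> (x, b - A *\<^sub>v x))) + ?g \<tau> \<le> \<beta> * F x" if "\<tau> \<in> P" for \<tau>
      using step(2)[OF _ _ that that that x] by (auto simp: F_def y_def)
    \<comment> \<open>Summing over all blocks and dividing by \<open>p * \<beta>\<close> is
      averaging over the uniform choice of the block.\<close>
    then have "(\<Sum>\<tau>\<in>P. \<beta> * F (fst (rbls_step A \<tau> (x, b - A *\<^sub>v x))) + ?g \<tau>) \<le> (\<Sum>\<tau>\<in>P. \<beta> * F x)"
      by (rule sum_mono)
    moreover have "(\<Sum>\<tau>\<in>P. ?g \<tau>) \<ge> \<sigma> * F x"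
      unfolding sum_transpose_col_submatrix[OF A part y] F_def \<sigma>_def y_def[symmetric]
      by (rule transpose_mult_vec_lower[OF A zero_le_power2 sv(2) v y_def])
    ultimately have "\<beta> * (\<Sum>\<tau>\<in>P. F (fst (rbls_step A \<tau> (x, b - A *\<^sub>v x)))) + \<sigma> * F x \<le> p * (\<beta> * F x)"
      by (simp add: sum.distrib sum_distrib_left p)
    then show ?thesis using \<beta>_pos p_pos by (simp add: c_def field_simps)
  qed
  \<comment> \<open>Needed to iterate the contraction. At an \<open>x\<close> whose error vector
    \<open>xs - x\<close> is a unit vector, \<open>F x\<close> is positive, while
    \<open>c * F x\<close> dominates an average of nonnegative errors.\<close>
  have c_nonneg: "c \<ge> 0"
  proof -
    define x where "x = xs - unit_vec d 0"
    have x: "x \<in> carrier_vec d" and eq: "xs - x = unit_vec d 0"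
      using xs d by (auto simp: x_def)
    have "F x > 0"
      using less_le_trans[OF \<sigma>, of "F x"] sv(2)[of "unit_vec d 0"] d by (simp add: F_def eq \<sigma>_def)
    moreover have "0 \<le> c * F x"
      by (rule order_trans[OF _ avg[OF x]]) (auto simp: F_def intro!: divide_nonneg_nonneg sum_nonneg sprod_self_nonneg)
    ultimately show ?thesis by (simp add: zero_le_mult_iff)
  qed
  define E where "E k = measure_pmf.expectation (rbls_state A b P k) (\<lambda>s. F (fst s))" for k
  have E_step: "E (Suc k) \<le> c * E k" for k
  proof -
    let ?S = "rbls_state A b P k"
    \<comment> \<open>Condition on the state after \<open>k\<close> steps; \<open>avg\<close> then
      bounds each conditional expectation.\<close>
    have "E (Suc k) = (\<Sum>s\<in>set_pmf ?S. pmf ?S s *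
        measure_pmf.expectation (map_pmf (\<lambda>\<tau>. rbls_step A \<tau> s) (pmf_of_set P)) (\<lambda>s. F (fst s)))"
      unfolding E_def rbls_state.simps using inv(1) P by (subst pmf_expectation_bind) auto
    also have "\<dots> \<le> (\<Sum>s\<in>set_pmf ?S. pmf ?S s * (c * F (fst s)))"
    proof (intro sum_mono mult_left_mono)
      fix s assume "s \<in> set_pmf ?S"
      then obtain x where "x \<in> carrier_vec d" "s = (x, b - A *\<^sub>v x)" using inv(2) by blast
      then show "measure_pmf.expectation (map_pmf (\<lambda>\<tau>. rbls_step A \<tau> s) (pmf_of_set P)) (\<lambda>s. F (fst s))
          \<le> c * F (fst s)"
        using avg P by (simp add: integral_pmf_of_set p)
    qed simp
    also have "\<dots> = c * E k"
      unfolding E_def using inv(1)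
      by (subst integral_measure_pmf_real[of "set_pmf ?S"]) (auto simp: sum_distrib_left ac_simps)
    finally show ?thesis .
  qed
  have E_le: "E k \<le> c ^ k * E 0" for k
  proof (induction k)
    case (Suc k)
    then show ?case
      using E_step[of k] mult_left_mono[OF Suc c_nonneg] by simp
  qed simp
  \<comment> \<open>The iteration starts at 0, so the initial error vector is \<open>xs\<close>
    itself.\<close>
  have "E 0 = (A *\<^sub>v xs) \<bullet> (A *\<^sub>v xs)"
    using A xs by (simp add: E_def F_def)
  also have "\<dots> \<le> (sigma_max A)\<^sup>2 * (norm2 xs)\<^sup>2"
    using sv(3)[OF xs(1)] by (simp add: norm2_square)
  finally have E0: "E 0 \<le> (sigma_max A)\<^sup>2 * (norm2 xs)\<^sup>2" .
  \<comment> \<open>The factor \<open>\<sigma>\<close> replaces a division: \<open>\<sigma>\<close>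
    times the squared error is at most \<open>F\<close>, and cancelling it at the end turns
    \<open>(sigma_max A)\<^sup>2\<close> into \<open>(kappa A)\<^sup>2\<close>.\<close>
  have "\<sigma> * measure_pmf.expectation (rbls_output A b P T) (\<lambda>x. (norm2 (xs - x))\<^sup>2)
      = measure_pmf.expectation (rbls_state A b P T) (\<lambda>s. \<sigma> * (norm2 (xs - fst s))\<^sup>2)"
    by (simp add: rbls_output_def)
  also have "\<dots> \<le> E T"
    unfolding E_def
  proof (intro integral_mono_AE integrable_measure_pmf_finite inv(1) AE_pmfI)
    fix s assume "s \<in> set_pmf (rbls_state A b P T)"
    then have "xs - fst s \<in> carrier_vec d" using inv(2) xs(1) by fastforce
    then show "\<sigma> * (norm2 (xs - fst s))\<^sup>2 \<le> F (fst s)"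
      using sv(2) by (simp add: F_def \<sigma>_def norm2_square)
  qed
  also have "\<dots> \<le> c ^ T * ((sigma_max A)\<^sup>2 * (norm2 xs)\<^sup>2)"
    using E_le[of T] mult_left_mono[OF E0, of "c ^ T"] c_nonneg by simp
  also have "\<dots> = \<sigma> * (c ^ T * (kappa A)\<^sup>2 * (norm2 xs)\<^sup>2)"
    using sv(1) by (simp add: kappa_def \<sigma>_def power_divide)
  finally show ?thesis
    using \<sigma> by (simp add: c_def \<sigma>_def xs_def)
qed

end
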